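(* Let $n\ge 5$, let $V$ be a three-dimensional real vector space with projective plane $P=\mathbb{P}(V)$, and let $A=(A_1,\ldots,A_n)\in P^n$ be generic, i.e. in general position (no three of the points lie on a common line). Let $T(A)\in P^n$ be the image of $A$ under the pentagram map. Then $$L_{T(A)}=L_A$$ as linear maps $V\to V$.
   Context: Indices are taken modulo $n$. For an $n$-tuple $A=(A_1,\ldots,A_n)$ of points of $P=\mathbb{P}(V)$ such that no three consecutive points $A_{j-1},A_j,A_{j+1}$ are collinear, choose arbitrary nonzero lifts $u_1,\ldots,u_n\in V$ of $A_1,\ldots,A_n$ and define the linear map $L_A:V\to V$ by $$L_A(v)=nv-\sum_{j=1}^n\frac{|u_{j-1},v,u_{j+1}|}{|u_{j-1},u_j,u_{j+1}|}\,u_j,$$ where $|\cdot,\cdot,\cdot|$ is any fixed nonzero determinantal (alternating trilinear) form on $V$. The map $L_A$ depends neither on the choice of the form nor on the choice of the lifts. The pentagram map $T$ sends $A$ to the $n$-tuple $B=T(A)$ with $B_i=\overleftrightarrow{A_{i-1}A_{i+1}}\cap\overleftrightarrow{A_iA_{i+2}}$, where $\overleftrightarrow{PQ}$ is the projective line through $P$ and $Q$. *)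

theory Defs
  imports Complex_Main
begin

text \<open>Throughout, V is a real vector space with \<open>dim (UNIV :: 'v set) = 3\<close> (this excludes infinite
  dimension, where \<open>dim\<close> is 0), and its projective plane consists of the one-dimensional subspaces
  of V, i.e. a projective point is the set of all its lifts together with 0.\<close>

definition proj_points :: "'v::real_vector set set" where
  "proj_points = {p. subspace p \<and> dim p = 1}"

text \<open>A projective line is represented by the two-dimensional subspace it comes from, so that the
  common point of two distinct lines is the intersection of the subspaces.\<close>

definition proj_line :: "'v::real_vector set \<Rightarrow> 'v set \<Rightarrow> 'v set" where
  "proj_line p q = span (p \<union> q)"

definition proj_collinear :: "'v::real_vector set \<Rightarrow> 'v set \<Rightarrow> 'v set \<Rightarrow> bool" where
  "proj_collinear p q r \<longleftrightarrow> (\<exists>S. subspace S \<and> dim S = 2 \<and> p \<subseteq> S \<and> q \<subseteq> S \<and> r \<subseteq> S)"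

text \<open>An n-tuple of points with indices read modulo n is an n-periodic sequence indexed by the
  integers.\<close>

definition polygon :: "nat \<Rightarrow> (int \<Rightarrow> 'v::real_vector set) \<Rightarrow> bool" where
  "polygon n A \<longleftrightarrow> (\<forall>i. A i \<in> proj_points) \<and> (\<forall>i. A (i + int n) = A i)"

definition general_position :: "nat \<Rightarrow> (int \<Rightarrow> 'v::real_vector set) \<Rightarrow> bool" where
  "general_position n A \<longleftrightarrow>
    (\<forall>i j k. i mod int n \<noteq> j mod int n \<and> i mod int n \<noteq> k mod int n \<and> j mod int n \<noteq> k mod int n \<longrightarrow>
       \<not> proj_collinear (A i) (A j) (A k))"

definition pentagram :: "(int \<Rightarrow> 'v::real_vector set) \<Rightarrow> int \<Rightarrow> 'v set" where
  "pentagram A i = proj_line (A (i - 1)) (A (i + 1)) \<inter> proj_line (A i) (A (i + 2))"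

definition det_form :: "('v::real_vector \<Rightarrow> 'v \<Rightarrow> 'v \<Rightarrow> real) \<Rightarrow> bool" where
  "det_form \<omega> \<longleftrightarrow>
     (\<forall>y z. linear (\<lambda>x. \<omega> x y z)) \<and> (\<forall>x z. linear (\<lambda>y. \<omega> x y z)) \<and> (\<forall>x y. linear (\<lambda>z. \<omega> x y z)) \<and>
     (\<forall>x y. \<omega> x x y = 0 \<and> \<omega> x y x = 0 \<and> \<omega> y x x = 0) \<and>
     (\<exists>x y z. \<omega> x y z \<noteq> 0)"

definition is_lift :: "'v::real_vector \<Rightarrow> 'v set \<Rightarrow> bool" where
  "is_lift u p \<longleftrightarrow> u \<in> p \<and> u \<noteq> 0"

definition glick_formula ::
    "nat \<Rightarrow> ('v::real_vector \<Rightarrow> 'v \<Rightarrow> 'v \<Rightarrow> real) \<Rightarrow> (int \<Rightarrow> 'v) \<Rightarrow> 'v \<Rightarrow> 'v" where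
  "glick_formula n \<omega> u v =
     real n *\<^sub>R v - (\<Sum>j = 1..int n. (\<omega> (u (j - 1)) v (u (j + 1)) / \<omega> (u (j - 1)) (u j) (u (j + 1))) *\<^sub>R u j)"

text \<open>The operator \<open>L\<^sub>A\<close>, for one choice of form and lifts; \<open>glick_operator_eq\<close> below shows that any
  other choice gives the same operator.\<close>

definition glick_operator :: "nat \<Rightarrow> (int \<Rightarrow> 'v::real_vector set) \<Rightarrow> 'v \<Rightarrow> 'v" where
  "glick_operator n A = glick_formula n (SOME \<omega>. det_form \<omega>) (\<lambda>j. SOME u. is_lift u (A j))"


subsection \<open>Determinantal forms in dimension three\<close>

lemma dim3_basis:
  assumes "dim (UNIV :: 'v::real_vector set) = 3"
  obtains e1 e2 e3 :: "'v::real_vector" where "independent {e1, e2, e3}" "e1 \<noteq> e2" "e1 \<noteq> e3" "e2 \<noteq> e3"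
    "span {e1, e2, e3} = UNIV"
proof -
  obtain B :: "'v set" where B: "independent B" "UNIV \<subseteq> span B" "card B = dim (UNIV :: 'v set)"
    by (rule basis_exists)
  then obtain e1 e2 e3 where "B = {e1, e2, e3}" "e1 \<noteq> e2" "e1 \<noteq> e3" "e2 \<noteq> e3"
    using assms by (metis card_3_iff)
  with B that show thesis by blast
qed

lemma span_3:
  assumes "x \<in> span {e1, e2, e3 :: 'v::real_vector}"
  obtains a b c where "x = a *\<^sub>R e1 + b *\<^sub>R e2 + c *\<^sub>R e3"
proof -
  obtain a where a: "x - a *\<^sub>R e1 \<in> span {e2, e3}" using assms by (auto simp: span_insert[of e1])
  then obtain b where b: "x - a *\<^sub>R e1 - b *\<^sub>R e2 \<in> span {e3}" by (auto simp: span_insert[of e2])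
  then obtain c where "x - a *\<^sub>R e1 - b *\<^sub>R e2 = c *\<^sub>R e3" by (auto simp: span_singleton)
  then have "x = a *\<^sub>R e1 + b *\<^sub>R e2 + c *\<^sub>R e3" by (simp add: algebra_simps)
  with that show thesis .
qed

lemma det_form_simps:
  assumes "det_form \<omega>"
  shows "\<omega> (x + x') y z = \<omega> x y z + \<omega> x' y z" "\<omega> x (y + y') z = \<omega> x y z + \<omega> x y' z"
    "\<omega> x y (z + z') = \<omega> x y z + \<omega> x y z'"
    "\<omega> (x - x') y z = \<omega> x y z - \<omega> x' y z" "\<omega> x (y - y') z = \<omega> x y z - \<omega> x y' z"
    "\<omega> x y (z - z') = \<omega> x y z - \<omega> x y z'"
    "\<omega> (a *\<^sub>R x) y z = a * \<omega> x y z" "\<omega> x (a *\<^sub>R y) z = a * \<omega> x y z" "\<omega> x y (a *\<^sub>R z) = a * \<omega> x y z"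
    "\<omega> 0 y z = 0" "\<omega> x 0 z = 0" "\<omega> x y 0 = 0"
    "\<omega> x x y = 0" "\<omega> x y x = 0" "\<omega> y x x = 0"
proof -
  have l: "linear (\<lambda>x. \<omega> x y z)" "linear (\<lambda>y. \<omega> x y z)" "linear (\<lambda>z. \<omega> x y z)" for x y z
    using assms by (auto simp: det_form_def)
  show "\<omega> (x + x') y z = \<omega> x y z + \<omega> x' y z" "\<omega> x (y + y') z = \<omega> x y z + \<omega> x y' z"
    "\<omega> x y (z + z') = \<omega> x y z + \<omega> x y z'"
    using l[THEN linear_add] by auto
  show "\<omega> (x - x') y z = \<omega> x y z - \<omega> x' y z" "\<omega> x (y - y') z = \<omega> x y z - \<omega> x y' z"
    "\<omega> x y (z - z') = \<omega> x y z - \<omega> x y z'"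
    using l[THEN linear_diff] by auto
  show "\<omega> (a *\<^sub>R x) y z = a * \<omega> x y z" "\<omega> x (a *\<^sub>R y) z = a * \<omega> x y z" "\<omega> x y (a *\<^sub>R z) = a * \<omega> x y z"
    using l[THEN linear_scale] by auto
  show "\<omega> 0 y z = 0" "\<omega> x 0 z = 0" "\<omega> x y 0 = 0"
    using l[THEN linear_0] by auto
  show "\<omega> x x y = 0" "\<omega> x y x = 0" "\<omega> y x x = 0"
    using assms by (auto simp: det_form_def)
qed

lemma det_form_antisym:
  assumes "det_form \<omega>"
  shows "\<omega> y x z = - \<omega> x y z" "\<omega> z y x = - \<omega> x y z" "\<omega> x z y = - \<omega> x y z"
proof -
  note simps = det_form_simps[OF assms]
  show "\<omega> y x z = - \<omega> x y z" using simps(13)[of "x + y" z, unfolded simps(1-3)] by (simp add: simps)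
  show "\<omega> z y x = - \<omega> x y z" using simps(14)[of "x + z" y, unfolded simps(1-3)] by (simp add: simps)
  show "\<omega> x z y = - \<omega> x y z" using simps(15)[of x "y + z", unfolded simps(1-3)] by (simp add: simps)
qed

lemma det_form_expand:
  assumes "det_form \<omega>"
  shows "\<omega> (a1 *\<^sub>R e1 + a2 *\<^sub>R e2 + a3 *\<^sub>R e3) (b1 *\<^sub>R e1 + b2 *\<^sub>R e2 + b3 *\<^sub>R e3)
           (c1 *\<^sub>R e1 + c2 *\<^sub>R e2 + c3 *\<^sub>R e3) =
         (a1 * (b2 * c3 - b3 * c2) - a2 * (b1 * c3 - b3 * c1) + a3 * (b1 * c2 - b2 * c1)) * \<omega> e1 e2 e3"
proof -
  have *: "\<omega> e2 e1 e3 = - \<omega> e1 e2 e3" "\<omega> e3 e2 e1 = - \<omega> e1 e2 e3" "\<omega> e1 e3 e2 = - \<omega> e1 e2 e3"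
    "\<omega> e2 e3 e1 = \<omega> e1 e2 e3" "\<omega> e3 e1 e2 = \<omega> e1 e2 e3"
    using det_form_antisym[OF assms] by (metis minus_minus)+
  show ?thesis
    unfolding det_form_simps[OF assms] * by (simp add: algebra_simps)
qed

lemma det_form_basis_nonzero:
  assumes "det_form \<omega>" "span {e1, e2, e3} = (UNIV :: 'v::real_vector set)"
  shows "\<omega> e1 e2 e3 \<noteq> 0"
proof
  assume 0: "\<omega> e1 e2 e3 = 0"
  have "\<omega> x y z = 0" for x y z
  proof -
    obtain a1 a2 a3 where x: "x = a1 *\<^sub>R e1 + a2 *\<^sub>R e2 + a3 *\<^sub>R e3"
      using span_3[of x e1 e2 e3] assms(2) by auto
    obtain b1 b2 b3 where y: "y = b1 *\<^sub>R e1 + b2 *\<^sub>R e2 + b3 *\<^sub>R e3"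
      using span_3[of y e1 e2 e3] assms(2) by auto
    obtain c1 c2 c3 where z: "z = c1 *\<^sub>R e1 + c2 *\<^sub>R e2 + c3 *\<^sub>R e3"
      using span_3[of z e1 e2 e3] assms(2) by auto
    show ?thesis unfolding x y z det_form_expand[OF assms(1)] by (simp add: 0)
  qed
  then show False using assms(1) by (auto simp: det_form_def)
qed

lemma det_form_unique:
  assumes dim: "dim (UNIV :: 'v::real_vector set) = 3"
    and \<omega>: "det_form \<omega>" and \<omega>': "det_form (\<omega>' :: 'v \<Rightarrow> 'v \<Rightarrow> 'v \<Rightarrow> real)"
  obtains k where "k \<noteq> 0" "\<And>x y z. \<omega>' x y z = k * \<omega> x y z"
proof -
  obtain e1 e2 e3 :: 'v where e: "span {e1, e2, e3} = UNIV" by (rule dim3_basis[OF dim])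
  note nz = det_form_basis_nonzero[OF \<omega> e] det_form_basis_nonzero[OF \<omega>' e]
  have *: "\<omega>' x y z = (\<omega>' e1 e2 e3 / \<omega> e1 e2 e3) * \<omega> x y z" for x y z
  proof -
    obtain a1 a2 a3 where x: "x = a1 *\<^sub>R e1 + a2 *\<^sub>R e2 + a3 *\<^sub>R e3"
      using span_3[of x e1 e2 e3] e by auto
    obtain b1 b2 b3 where y: "y = b1 *\<^sub>R e1 + b2 *\<^sub>R e2 + b3 *\<^sub>R e3"
      using span_3[of y e1 e2 e3] e by auto
    obtain c1 c2 c3 where z: "z = c1 *\<^sub>R e1 + c2 *\<^sub>R e2 + c3 *\<^sub>R e3"
      using span_3[of z e1 e2 e3] e by auto
    show ?thesis unfolding x y z det_form_expand[OF \<omega>] det_form_expand[OF \<omega>'] using nz by simp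
  qed
  show thesis by (rule that[OF _ *]) (use nz in simp)
qed

lemma det_form_exists:
  assumes dim: "dim (UNIV :: 'v::real_vector set) = 3"
  shows "\<exists>\<omega> :: 'v \<Rightarrow> 'v \<Rightarrow> 'v \<Rightarrow> real. det_form \<omega>"
proof -
  obtain e1 e2 e3 :: 'v where e: "independent {e1, e2, e3}" "e1 \<noteq> e2" "e1 \<noteq> e3" "e2 \<noteq> e3"
    "span {e1, e2, e3} = UNIV" by (rule dim3_basis[OF dim])
  define c where "c = (\<lambda>b x. representation {e1, e2, e3} x b)"
  have add: "c b (x + y) = c b x + c b y" and scale: "c b (r *\<^sub>R x) = r * c b x" for b x y r
    using e by (simp_all add: c_def real_vector.representation_add real_vector.representation_scale)
  have basis: "c b e = (if b = e then 1 else 0)" if "e \<in> {e1, e2, e3}" for b e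
    using real_vector.representation_basis[OF e(1) that] by (simp add: c_def)
  define \<omega> where "\<omega> = (\<lambda>x y z. c e1 x * (c e2 y * c e3 z - c e3 y * c e2 z)
      - c e2 x * (c e1 y * c e3 z - c e3 y * c e1 z) + c e3 x * (c e1 y * c e2 z - c e2 y * c e1 z))"
  have "\<omega> e1 e2 e3 = 1" using e by (auto simp: \<omega>_def basis)
  then have "\<exists>x y z. \<omega> x y z \<noteq> 0" by (metis zero_neq_one)
  then have "det_form \<omega>"
    unfolding det_form_def
    by (auto intro!: linearI simp: add scale \<omega>_def algebra_simps)
  then show ?thesis by blast
qed


subsection \<open>The operator is well defined\<close>

lemma proj_point_lift_exists:
  assumes "p \<in> proj_points"
  shows "\<exists>u. is_lift u p"
proof (rule ccontr)
  assume "\<nexists>u. is_lift u p"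
  then have p: "p \<subseteq> {0}" by (auto simp: is_lift_def)
  obtain B where B: "B \<subseteq> p" "independent B" "card B = dim p" by (rule basis_exists)
  have "0 \<notin> B" using B(2) real_vector.dependent_zero by blast
  then have "B = {}" using B(1) p by blast
  then have "dim p = 0" using B by simp
  then show False using assms by (simp add: proj_points_def)
qed

lemma proj_point_eq_span:
  assumes "p \<in> proj_points" "is_lift u p"
  shows "p = span {u}"
proof -
  have p: "subspace p" "dim p = 1" "u \<in> p" "u \<noteq> 0"
    using assms by (auto simp: proj_points_def is_lift_def)
  obtain B where B: "B \<subseteq> p" "independent B" "p \<subseteq> span B" "card B = dim p"
    by (rule basis_exists)
  then obtain b where "B = {b}" using p by (metis card_1_singletonE)
  then obtain a where a: "u = a *\<^sub>R b" using B p by (auto simp: span_singleton)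
  then have "a \<noteq> 0" using p by auto
  with a have "b = (1 / a) *\<^sub>R u" by simp
  then have "b \<in> span {u}" by (metis span_base span_scale singletonI)
  then have "span B \<subseteq> span {u}" using \<open>B = {b}\<close> by (simp add: span_minimal)
  moreover have "span {u} \<subseteq> p" using p by (simp add: span_minimal)
  ultimately show ?thesis using B by blast
qed

lemma span_singleton_proj_point:
  assumes "(u :: 'v::real_vector) \<noteq> 0"
  shows "span {u} \<in> proj_points" "is_lift u (span {u})"
  using assms by (auto simp: proj_points_def is_lift_def dim_eq_card_independent span_base)

lemma glick_operator_eq:
  fixes A :: "int \<Rightarrow> 'v::real_vector set"
  assumes dim: "dim (UNIV :: 'v set) = 3" and A: "\<And>j. A j \<in> proj_points"
    and \<omega>: "det_form \<omega>" and u: "\<And>j. is_lift (u j) (A j)"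
  shows "glick_operator n A = glick_formula n \<omega> u"
proof
  fix v
  define \<omega>' :: "'v \<Rightarrow> 'v \<Rightarrow> 'v \<Rightarrow> real" where "\<omega>' = (SOME \<omega>. det_form \<omega>)"
  define u' where "u' = (\<lambda>j. SOME u. is_lift u (A j))"
  have \<omega>': "det_form \<omega>'" unfolding \<omega>'_def using det_form_exists[OF dim] by (rule someI_ex)
  have u': "is_lift (u' j) (A j)" for j
    unfolding u'_def using proj_point_lift_exists[OF A] by (rule someI_ex)
  obtain k where k: "k \<noteq> 0" "\<And>x y z. \<omega>' x y z = k * \<omega> x y z"
    using det_form_unique[OF dim \<omega> \<omega>'] by blast
  have "\<exists>c. c \<noteq> 0 \<and> u' j = c *\<^sub>R u j" for j
  proof -
    have "u' j \<in> span {u j}" "u' j \<noteq> 0"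
      using u'[of j] proj_point_eq_span[OF A u, of j] by (auto simp: is_lift_def)
    then show ?thesis by (auto simp: span_singleton)
  qed
  then obtain c where c: "\<And>j. c j \<noteq> 0" "\<And>j. u' j = c j *\<^sub>R u j" by metis
  have "(\<omega>' (u' (j - 1)) v (u' (j + 1)) / \<omega>' (u' (j - 1)) (u' j) (u' (j + 1))) *\<^sub>R u' j =
        (\<omega> (u (j - 1)) v (u (j + 1)) / \<omega> (u (j - 1)) (u j) (u (j + 1))) *\<^sub>R u j" for j
    using k(1) c(1) by (simp add: k(2) c(2) det_form_simps[OF \<omega>])
  then show "glick_operator n A v = glick_formula n \<omega> u v"
    unfolding glick_operator_def glick_formula_def \<omega>'_def[symmetric] u'_def[symmetric] by simp
qed

lemma linear_glick_operator:
  assumes dim: "dim (UNIV :: 'v::real_vector set) = 3"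
  shows "linear (glick_operator n (A :: int \<Rightarrow> 'v set))"
proof -
  define \<omega> :: "'v \<Rightarrow> 'v \<Rightarrow> 'v \<Rightarrow> real" where "\<omega> = (SOME \<omega>. det_form \<omega>)"
  have \<omega>: "det_form \<omega>" unfolding \<omega>_def using det_form_exists[OF dim] by (rule someI_ex)
  show ?thesis
    unfolding glick_operator_def glick_formula_def \<omega>_def[symmetric]
    by (intro linearI)
      (simp_all add: det_form_simps[OF \<omega>] algebra_simps add_divide_distrib sum.distrib scaleR_sum_right)
qed


subsection \<open>The pentagram map is well defined on polygons in general position\<close>

lemma not_collinear_imp_det_nonzero:
  fixes u v w :: "'v::real_vector"
  assumes dim: "dim (UNIV :: 'v set) = 3" and \<omega>: "det_form \<omega>"
    and nc: "\<not> proj_collinear (span {u}) (span {v}) (span {w})"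
  shows "\<omega> u v w \<noteq> 0"
proof -
  obtain B where B: "B \<subseteq> {u, v, w}" "independent B" "{u, v, w} \<subseteq> span B"
    using maximal_independent_subset[of "{u, v, w}"] by blast
  have finB: "finite B" using B(1) by (rule finite_subset) simp
  obtain C where C: "B \<subseteq> C" "independent C" "span C = UNIV"
    using extend_basis_superset[OF B(2)] independent_extend_basis[OF B(2)] span_extend_basis[OF B(2)]
    by blast
  have cC: "card C = 3" using dim_eq_card[of C UNIV] C dim by simp
  then have finC: "finite C" by (intro card_ge_0_finite) simp
  show ?thesis
  proof (cases "card B \<le> 2")
    case True
    obtain D where D: "B \<subseteq> D" "D \<subseteq> C" "card D = 2"
      using exists_subset_between[OF True _ C(1) finC] cC by auto
    have "independent D" using D(2) C(2) by (meson real_vector.independent_mono)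
    then have "dim (span D) = 2" using D(3) by (simp add: dim_eq_card_independent)
    moreover have "span B \<subseteq> span D" using D(1) by (rule span_mono)
    then have "u \<in> span D" "v \<in> span D" "w \<in> span D" using B(3) by auto
    ultimately have "proj_collinear (span {u}) (span {v}) (span {w})"
      unfolding proj_collinear_def by (intro exI[of _ "span D"]) (simp add: span_minimal)
    then show ?thesis using nc by contradiction
  next
    case False
    then have "B = C" using C(1) cC finC by (intro card_subset_eq) (auto dest: card_mono)
    then have "span {u, v, w} = UNIV" using B(1) C(3) by (metis span_mono top.extremum_uniqueI)
    then show ?thesis by (rule det_form_basis_nonzero[OF \<omega>])
  qed
qed

lemma det_nonzero_imp_not_collinear:
  fixes u v w :: "'v::real_vector"
  assumes \<omega>: "det_form \<omega>" and nz: "\<omega> u v w \<noteq> 0"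
  shows "\<not> proj_collinear (span {u}) (span {v}) (span {w})"
proof
  assume "proj_collinear (span {u}) (span {v}) (span {w})"
  then obtain S where S: "dim S = 2" "u \<in> S" "v \<in> S" "w \<in> S"
    by (auto simp: proj_collinear_def dest: subsetD[OF _ span_base[OF singletonI]])
  obtain B where B: "S \<subseteq> span B" "card B = dim S" by (rule basis_exists)
  then obtain a b where "B = {a, b}" using S by (metis card_2_iff)
  then have "S \<subseteq> span {a, b, 0}" using B span_mono[of "{a, b}" "{a, b, 0}"] by auto
  obtain a1 a2 a3 where u: "u = a1 *\<^sub>R a + a2 *\<^sub>R b + a3 *\<^sub>R 0"
    using span_3[of u a b 0] S(2) \<open>S \<subseteq> span {a, b, 0}\<close> by blast
  obtain b1 b2 b3 where v: "v = b1 *\<^sub>R a + b2 *\<^sub>R b + b3 *\<^sub>R 0"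
    using span_3[of v a b 0] S(3) \<open>S \<subseteq> span {a, b, 0}\<close> by blast
  obtain c1 c2 c3 where w: "w = c1 *\<^sub>R a + c2 *\<^sub>R b + c3 *\<^sub>R 0"
    using span_3[of w a b 0] S(4) \<open>S \<subseteq> span {a, b, 0}\<close> by blast
  have "\<omega> u v w = 0"
    unfolding u v w det_form_expand[OF \<omega>] by (simp add: det_form_simps[OF \<omega>])
  then show False using nz by contradiction
qed

lemma det_form_four_vectors:
  fixes a b c d :: "'v::real_vector"
  assumes dim: "dim (UNIV :: 'v set) = 3" and \<omega>: "det_form \<omega>"
  shows "\<omega> a b d *\<^sub>R c + \<omega> b c d *\<^sub>R a = \<omega> a c d *\<^sub>R b + \<omega> a b c *\<^sub>R d"
proof -
  obtain e1 e2 e3 :: 'v where e: "span {e1, e2, e3} = UNIV" by (rule dim3_basis[OF dim])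
  obtain a1 a2 a3 where a: "a = a1 *\<^sub>R e1 + a2 *\<^sub>R e2 + a3 *\<^sub>R e3"
    using span_3[of a e1 e2 e3] e by auto
  obtain b1 b2 b3 where b: "b = b1 *\<^sub>R e1 + b2 *\<^sub>R e2 + b3 *\<^sub>R e3"
    using span_3[of b e1 e2 e3] e by auto
  obtain c1 c2 c3 where c: "c = c1 *\<^sub>R e1 + c2 *\<^sub>R e2 + c3 *\<^sub>R e3"
    using span_3[of c e1 e2 e3] e by auto
  obtain d1 d2 d3 where d: "d = d1 *\<^sub>R e1 + d2 *\<^sub>R e2 + d3 *\<^sub>R e3"
    using span_3[of d e1 e2 e3] e by auto
  have eqI: "p = p' \<Longrightarrow> q = q' \<Longrightarrow> r = r' \<Longrightarrow>
      p *\<^sub>R e1 + q *\<^sub>R e2 + r *\<^sub>R e3 = p' *\<^sub>R e1 + q' *\<^sub>R e2 + r' *\<^sub>R e3" for p q r p' q' r' by simp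
  have comb: "s *\<^sub>R (p *\<^sub>R e1 + q *\<^sub>R e2 + r *\<^sub>R e3) + s' *\<^sub>R (p' *\<^sub>R e1 + q' *\<^sub>R e2 + r' *\<^sub>R e3) =
      (s * p + s' * p') *\<^sub>R e1 + (s * q + s' * q') *\<^sub>R e2 + (s * r + s' * r') *\<^sub>R e3"
    for s s' p q r p' q' r' by (simp add: algebra_simps)
  show ?thesis
    unfolding a b c d det_form_expand[OF \<omega>] comb by (rule eqI; algebra)
qed

text \<open>A lift of the common point of the lines ac and bd, from the linear relation among four vectors.\<close>

lemma lines_meet:
  fixes a b c d :: "'v::real_vector"
  assumes dim: "dim (UNIV :: 'v set) = 3" and \<omega>: "det_form \<omega>"
    and nz: "\<omega> a b d \<noteq> 0" "\<omega> a b c \<noteq> 0"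
  defines "w \<equiv> \<omega> a b d *\<^sub>R c + \<omega> b c d *\<^sub>R a"
  shows "proj_line (span {a}) (span {c}) \<inter> proj_line (span {b}) (span {d}) = span {w}" "w \<noteq> 0"
proof -
  have line: "proj_line (span {p}) (span {q}) = {x. \<exists>s t. x = s *\<^sub>R p + t *\<^sub>R q}" for p q :: 'v
    unfolding proj_line_def span_Un span_span by (auto simp: span_singleton)
  have w: "w = \<omega> a c d *\<^sub>R b + \<omega> a b c *\<^sub>R d"
    unfolding w_def by (rule det_form_four_vectors[OF dim \<omega>])
  have "\<omega> a b w = \<omega> a b d * \<omega> a b c" by (simp add: w_def det_form_simps[OF \<omega>])
  then show "w \<noteq> 0" using nz by (auto simp: det_form_simps[OF \<omega>])
  show "proj_line (span {a}) (span {c}) \<inter> proj_line (span {b}) (span {d}) = span {w}"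
  proof (intro equalityI subsetI)
    fix x assume "x \<in> proj_line (span {a}) (span {c}) \<inter> proj_line (span {b}) (span {d})"
    then obtain s t s' t' where x: "x = s *\<^sub>R a + t *\<^sub>R c" "x = s' *\<^sub>R b + t' *\<^sub>R d"
      unfolding line by blast
    have "\<omega> x b d = 0" unfolding x(2) by (simp add: det_form_simps[OF \<omega>])
    then have "s * \<omega> a b d = t * \<omega> b c d"
      unfolding x(1) by (simp add: det_form_simps[OF \<omega>] det_form_antisym(1)[OF \<omega>, of c b])
    then have "s = t / \<omega> a b d * \<omega> b c d" using nz by (simp add: field_simps)
    then have "x = (t / \<omega> a b d) *\<^sub>R w" unfolding x(1) w_def using nz by (simp add: algebra_simps)
    then show "x \<in> span {w}" by (auto simp: span_singleton)
  next
    fix x assume "x \<in> span {w}"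
    then obtain r where r: "x = r *\<^sub>R w" by (auto simp: span_singleton)
    have "x = (r * \<omega> b c d) *\<^sub>R a + (r * \<omega> a b d) *\<^sub>R c" unfolding r w_def by (simp add: algebra_simps)
    moreover have "x = (r * \<omega> a c d) *\<^sub>R b + (r * \<omega> a b c) *\<^sub>R d" unfolding r w by (simp add: algebra_simps)
    ultimately show "x \<in> proj_line (span {a}) (span {c}) \<inter> proj_line (span {b}) (span {d})"
      unfolding line by blast
  qed
qed

lemma pentagram_well_defined:
  fixes A :: "int \<Rightarrow> 'v::real_vector set"
  assumes n: "n \<ge> 5" and dim: "dim (UNIV :: 'v set) = 3"
    and A: "polygon n A" and gp: "general_position n A"
  shows "polygon n (pentagram A)"
    and "\<not> proj_collinear (pentagram A (j - 1)) (pentagram A j) (pentagram A (j + 1))"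
proof -
  obtain \<omega> :: "'v \<Rightarrow> 'v \<Rightarrow> 'v \<Rightarrow> real" where \<omega>: "det_form \<omega>" using det_form_exists[OF dim] by blast
  have pts: "A i \<in> proj_points" for i using A by (simp add: polygon_def)
  obtain u where u: "\<And>i. is_lift (u i) (A i)" using proj_point_lift_exists[OF pts] by metis
  have Au: "A i = span {u i}" for i by (rule proj_point_eq_span[OF pts u])
  have distinct: "i mod int n \<noteq> k mod int n" if "i < k" "k < i + 5" for i k
  proof
    assume "i mod int n = k mod int n"
    then have "int n dvd k - i" by (metis mod_eq_dvd_iff)
    then show False using that n by (auto dest!: zdvd_imp_le)
  qed
  have nz: "\<omega> (u i) (u k) (u l) \<noteq> 0" if "i < k" "k < l" "l < i + 5" for i k l
  proof (rule not_collinear_imp_det_nonzero[OF dim \<omega>])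
    have "i mod int n \<noteq> k mod int n" "i mod int n \<noteq> l mod int n" "k mod int n \<noteq> l mod int n"
      using that distinct[of i k] distinct[of i l] distinct[of k l] by simp_all
    then show "\<not> proj_collinear (span {u i}) (span {u k}) (span {u l})"
      using gp by (auto simp: general_position_def Au)
  qed
  define w where "w = (\<lambda>i. \<omega> (u (i - 1)) (u i) (u (i + 2)) *\<^sub>R u (i + 1)
                         + \<omega> (u i) (u (i + 1)) (u (i + 2)) *\<^sub>R u (i - 1))"
  have w': "w i = \<omega> (u (i - 1)) (u (i + 1)) (u (i + 2)) *\<^sub>R u i
                + \<omega> (u (i - 1)) (u i) (u (i + 1)) *\<^sub>R u (i + 2)" for i
    unfolding w_def by (rule det_form_four_vectors[OF dim \<omega>])
  have Tw: "pentagram A i = span {w i}" and w0: "w i \<noteq> 0" for i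
    unfolding pentagram_def Au w_def by (rule lines_meet[OF dim \<omega> nz nz]; simp)+
  have "pentagram A (i + int n) = pentagram A i" for i
  proof -
    have "A (i + int n + k) = A (i + k)" for k
      using A unfolding polygon_def by (metis add.assoc add.commute)
    from this[of "-1"] this[of 0] this[of 1] this[of 2] show ?thesis by (simp add: pentagram_def)
  qed
  then show "polygon n (pentagram A)"
    using w0 by (simp add: polygon_def Tw span_singleton_proj_point)
  show "\<not> proj_collinear (pentagram A (j - 1)) (pentagram A j) (pentagram A (j + 1))"
    unfolding Tw
  proof (rule det_nonzero_imp_not_collinear[OF \<omega>])
    let ?a = "u (j - 2)" and ?b = "u (j - 1)" and ?c = "u j" and ?d = "u (j + 1)" and ?e = "u (j + 2)"
      and ?f = "u (j + 3)"
    have ws: "w (j - 1) = \<omega> ?a ?c ?d *\<^sub>R ?b + \<omega> ?a ?b ?c *\<^sub>R ?d"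
      "w j = \<omega> ?b ?c ?e *\<^sub>R ?d + \<omega> ?c ?d ?e *\<^sub>R ?b"
      "w (j + 1) = \<omega> ?c ?e ?f *\<^sub>R ?d + \<omega> ?c ?d ?e *\<^sub>R ?f"
      using w'[of "j - 1"] w_def w'[of "j + 1"] by (simp_all add: algebra_simps)
    have ww: "\<omega> (w (j - 1)) (w j) (w (j + 1)) =
        (\<omega> ?a ?c ?d * \<omega> ?b ?c ?e - \<omega> ?a ?b ?c * \<omega> ?c ?d ?e) * \<omega> ?c ?d ?e * \<omega> ?b ?d ?f"
    proof -
      have "\<omega> (p *\<^sub>R b + q *\<^sub>R d) (r *\<^sub>R d + s *\<^sub>R b) (t *\<^sub>R d + s *\<^sub>R f) = (p * r - q * s) * s * \<omega> b d f"
        for p q r s t and b d f :: 'v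
        by (simp add: det_form_simps[OF \<omega>] det_form_antisym(1)[OF \<omega>, of d b] algebra_simps)
      then show ?thesis unfolding ws .
    qed
    have plucker: "\<omega> a c d * \<omega> b c e - \<omega> a b c * \<omega> c d e = \<omega> b c d * \<omega> a c e" for a b c d e :: 'v
    proof -
      have "\<omega> (\<omega> a b d *\<^sub>R c + \<omega> b c d *\<^sub>R a) c e = \<omega> (\<omega> a c d *\<^sub>R b + \<omega> a b c *\<^sub>R d) c e"
        by (simp only: det_form_four_vectors[OF dim \<omega>, of a b d c])
      then show ?thesis
        by (simp add: det_form_simps[OF \<omega>] det_form_antisym(1)[OF \<omega>, of d c])
    qed
    have "\<omega> ?b ?c ?d \<noteq> 0" "\<omega> ?a ?c ?e \<noteq> 0" "\<omega> ?c ?d ?e \<noteq> 0" "\<omega> ?b ?d ?f \<noteq> 0"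
      by (rule nz; simp)+
    then show "\<omega> (w (j - 1)) (w j) (w (j + 1)) \<noteq> 0" unfolding ww plucker by simp
  qed
qed

end

theory Submission
  imports Defs
begin

text \<open>Let \<open>P\<^sub>j\<close> be the j-th summand of the formula for A, i.e. the projection onto \<open>A\<^sub>j\<close> along
  the line \<open>A\<^sub>j\<^sub>-\<^sub>1A\<^sub>j\<^sub>+\<^sub>1\<close>, and \<open>Q\<^sub>j\<close> the one for \<open>B = T(A)\<close>. Expand v in the basis of lifts of
  \<open>B\<^sub>j\<^sub>-\<^sub>1, B\<^sub>j, B\<^sub>j\<^sub>+\<^sub>1\<close>. As \<open>B\<^sub>j\<close> lies on the lines \<open>A\<^sub>j\<^sub>-\<^sub>1A\<^sub>j\<^sub>+\<^sub>1\<close> and \<open>A\<^sub>jA\<^sub>j\<^sub>+\<^sub>2\<close>, the two outer components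
  are \<open>P\<^sub>j(v) - M\<^sub>j\<close> and \<open>P\<^sub>j\<^sub>+\<^sub>1(v) - N\<^sub>j\<close> with multiples \<open>M\<^sub>j, N\<^sub>j\<close> of \<open>B\<^sub>j\<close>. The poles of \<open>M\<^sub>j\<close> and
  \<open>N\<^sub>j\<^sub>+\<^sub>1\<close> along collinear \<open>A\<^sub>j\<^sub>-\<^sub>1, A\<^sub>j\<^sub>+\<^sub>1, A\<^sub>j\<^sub>+\<^sub>3\<close> cancel, and in fact
  \<open>M\<^sub>j + N\<^sub>j\<^sub>+\<^sub>1 = P\<^sub>j(v) + P\<^sub>j\<^sub>+\<^sub>1(v) + P\<^sub>j\<^sub>+\<^sub>2(v) - v\<close>. Hence \<open>Q\<^sub>j(v) = P\<^sub>j\<^sub>-\<^sub>1(v) + M\<^sub>j - M\<^sub>j\<^sub>-\<^sub>1\<close>,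
  and summing over a period gives the theorem.\<close>

lemma eq_divide_scaleRI:
  fixes z t :: "'v::real_vector"
  assumes "k \<noteq> 0" "k *\<^sub>R z = t"
  shows "z = (1 / k) *\<^sub>R t"
  using assms by auto

lemma det_form_cycle:
  assumes "det_form \<omega>"
  shows "\<omega> y z x = \<omega> x y z"
  using det_form_antisym[OF assms] by (metis minus_minus)

text \<open>Cramer's rule is the linear relation among x, y, z, v, solved for v.\<close>

lemma det_form_cramer:
  fixes x y z v :: "'v::real_vector"
  assumes dim: "dim (UNIV :: 'v set) = 3" and \<omega>: "det_form \<omega>" and nz: "\<omega> x y z \<noteq> 0"
  shows "v = (\<omega> v y z / \<omega> x y z) *\<^sub>R x + (\<omega> x v z / \<omega> x y z) *\<^sub>R y + (\<omega> x y v / \<omega> x y z) *\<^sub>R z"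
proof -
  have "\<omega> y v z = - \<omega> v y z" by (rule det_form_antisym(1)[OF \<omega>])
  then have "\<omega> x y z *\<^sub>R v - \<omega> v y z *\<^sub>R x = \<omega> x v z *\<^sub>R y + \<omega> x y v *\<^sub>R z"
    using det_form_four_vectors[OF dim \<omega>, of x y z v] by simp
  then have "\<omega> x y z *\<^sub>R v = \<omega> v y z *\<^sub>R x + \<omega> x v z *\<^sub>R y + \<omega> x y v *\<^sub>R z"
    by (simp only: diff_eq_eq add_ac)
  from eq_divide_scaleRI[OF nz this] show ?thesis by (simp add: scaleR_add_right)
qed

text \<open>Inserting the linear relation among p, q, r, t into \<open>\<omega> _ s t\<close> kills
  its t-term and leaves the three-term Pluecker relation.\<close>

lemma det_form_plucker:
  fixes p q r s t :: "'v::real_vector"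
  assumes dim: "dim (UNIV :: 'v set) = 3" and \<omega>: "det_form \<omega>"
  shows "\<omega> p q t * \<omega> r s t - \<omega> p r t * \<omega> q s t + \<omega> p s t * \<omega> q r t = 0"
proof -
  have "\<omega> (\<omega> p q t *\<^sub>R r + \<omega> q r t *\<^sub>R p) s t = \<omega> (\<omega> p r t *\<^sub>R q + \<omega> p q r *\<^sub>R t) s t"
    by (simp only: det_form_four_vectors[OF dim \<omega>, of p q t r])
  then show ?thesis by (simp add: det_form_simps[OF \<omega>] algebra_simps)
qed

text \<open>A lift of the point \<open>ac \<inter> bd\<close>.\<close>

definition meet_lift :: "('v::real_vector \<Rightarrow> 'v \<Rightarrow> 'v \<Rightarrow> real) \<Rightarrow> 'v \<Rightarrow> 'v \<Rightarrow> 'v \<Rightarrow> 'v \<Rightarrow> 'v" where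
  "meet_lift \<omega> a b c d = \<omega> a b d *\<^sub>R c + \<omega> b c d *\<^sub>R a"

lemma meet_lift_alt:
  fixes a b c d :: "'v::real_vector"
  assumes "dim (UNIV :: 'v set) = 3" "det_form \<omega>"
  shows "meet_lift \<omega> a b c d = \<omega> a c d *\<^sub>R b + \<omega> a b c *\<^sub>R d"
  unfolding meet_lift_def by (rule det_form_four_vectors[OF assms])

definition glick_term :: "('v::real_vector \<Rightarrow> 'v \<Rightarrow> 'v \<Rightarrow> real) \<Rightarrow> 'v \<Rightarrow> 'v \<Rightarrow> 'v \<Rightarrow> 'v \<Rightarrow> 'v" where
  "glick_term \<omega> a b c v = (\<omega> a v c / \<omega> a b c) *\<^sub>R b"

text \<open>\<open>corr_right\<close> and \<open>corr_left\<close> are the corrections \<open>M\<^sub>j\<close> and \<open>N\<^sub>j\<close>, for lifts a, ..., f of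
  \<open>A\<^sub>j\<^sub>-\<^sub>2, ..., A\<^sub>j\<^sub>+\<^sub>3\<close>.\<close>

definition corr_right :: "('v::real_vector \<Rightarrow> 'v \<Rightarrow> 'v \<Rightarrow> real) \<Rightarrow> 'v \<Rightarrow> 'v \<Rightarrow> 'v \<Rightarrow> 'v \<Rightarrow> 'v \<Rightarrow> 'v \<Rightarrow> 'v" where
  "corr_right \<omega> b c d e f v =
     - (\<omega> c d f * \<omega> b d v / (\<omega> b c d * \<omega> c d e * \<omega> b d f)) *\<^sub>R meet_lift \<omega> b c d e"

definition corr_left :: "('v::real_vector \<Rightarrow> 'v \<Rightarrow> 'v \<Rightarrow> real) \<Rightarrow> 'v \<Rightarrow> 'v \<Rightarrow> 'v \<Rightarrow> 'v \<Rightarrow> 'v \<Rightarrow> 'v \<Rightarrow> 'v" where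
  "corr_left \<omega> a b c d e v =
     - (\<omega> a c d * \<omega> c e v / (\<omega> c d e * \<omega> b c d * \<omega> a c e)) *\<^sub>R meet_lift \<omega> b c d e"

text \<open>Since x, y lie on the line bd and y, z on the line ce, the Cramer coefficients of z and
  x depend on v only through \<open>\<omega> b d v\<close> and \<open>\<omega> c e v\<close>.
  Writing z by y and c, and x by y and d, turns the outer components into multiples of c and d plus
  a correction along y.\<close>

lemma glick_term_meet_lift:
  fixes a b c d e f v :: "'v::real_vector"
  assumes dim: "dim (UNIV :: 'v set) = 3" and \<omega>: "det_form \<omega>"
    and nz: "\<omega> b c d \<noteq> 0" "\<omega> c d e \<noteq> 0" "\<omega> a c e \<noteq> 0" "\<omega> b d f \<noteq> 0"
  defines "x \<equiv> meet_lift \<omega> a b c d" and "y \<equiv> meet_lift \<omega> b c d e" and "z \<equiv> meet_lift \<omega> c d e f"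
  assumes xyz: "\<omega> x y z \<noteq> 0"
  shows "glick_term \<omega> x y z v = v - glick_term \<omega> b c d v - glick_term \<omega> c d e v
    + corr_right \<omega> b c d e f v + corr_left \<omega> a b c d e v"
proof -
  note simps = det_form_simps[OF \<omega>]
  note anti = det_form_antisym[OF \<omega>]
  note cyc = det_form_cycle[OF \<omega>]
  note alt = meet_lift_alt[OF dim \<omega>]
  have x: "x = \<omega> a b d *\<^sub>R c + \<omega> b c d *\<^sub>R a" "x = \<omega> a c d *\<^sub>R b + \<omega> a b c *\<^sub>R d"
    unfolding x_def by (rule meet_lift_def alt)+
  have y: "y = \<omega> b c e *\<^sub>R d + \<omega> c d e *\<^sub>R b" "y = \<omega> b d e *\<^sub>R c + \<omega> b c d *\<^sub>R e"
    unfolding y_def by (rule meet_lift_def alt)+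
  have z: "z = \<omega> c d f *\<^sub>R e + \<omega> d e f *\<^sub>R c" "z = \<omega> c e f *\<^sub>R d + \<omega> c d e *\<^sub>R f"
    unfolding z_def by (rule meet_lift_def alt)+
  \<comment> \<open>\<open>pl1\<close> gives the coefficient of c when e is eliminated between y and
    z; \<open>pl2\<close> does the same for d when b is eliminated between x and y.\<close>
  have pl1: "\<omega> b c d * \<omega> d e f = \<omega> b d e * \<omega> c d f - \<omega> b d f * \<omega> c d e"
    using det_form_plucker[OF dim \<omega>, of b c d e f]
    by (simp add: anti(3)[of _ d] cyc[of _ _ d, symmetric])
  have pl2: "\<omega> a b c * \<omega> c d e = \<omega> a c d * \<omega> b c e - \<omega> a c e * \<omega> b c d"
    using det_form_plucker[OF dim \<omega>, of a b c d e]
    by (simp add: anti(3)[of _ c] cyc[of _ _ c, symmetric])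
  have bdz: "\<omega> b d z = \<omega> c d e * \<omega> b d f"
    by (simp add: z(2) simps)
  have xce: "\<omega> x c e = \<omega> b c d * \<omega> a c e"
    by (simp add: x(1) simps)
  \<comment> \<open>The factor in front does not depend on t, so it cancels in the quotient of the
    values at v and z; it is nonzero because \<open>\<omega> x y z\<close> is.\<close>
  have xy: "\<omega> x y t = (\<omega> a c d * \<omega> b c e - \<omega> a b c * \<omega> c d e) * \<omega> b d t" for t
    by (simp add: x(2) y(1) simps anti(1)[of d b] algebra_simps)
  have yz: "\<omega> t y z = (\<omega> b d e * \<omega> c d f - \<omega> b c d * \<omega> d e f) * \<omega> t c e" for t
    by (simp add: y(2) z(1) simps anti(3)[of t e c] algebra_simps)
  have "\<omega> x y v / \<omega> x y z = \<omega> b d v / (\<omega> c d e * \<omega> b d f)"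
    using xyz by (simp add: xy bdz)
  moreover have "\<omega> b c d *\<^sub>R z = \<omega> c d f *\<^sub>R y - (\<omega> c d e * \<omega> b d f) *\<^sub>R c"
    by (simp add: y(2) z(1) scaleR_add_right pl1 scaleR_diff_left mult.commute)
  then have "z = (1 / \<omega> b c d) *\<^sub>R (\<omega> c d f *\<^sub>R y - (\<omega> c d e * \<omega> b d f) *\<^sub>R c)"
    using nz by (intro eq_divide_scaleRI) simp_all
  ultimately have 1: "(\<omega> x y v / \<omega> x y z) *\<^sub>R z = glick_term \<omega> b c d v - corr_right \<omega> b c d e f v"
    using nz by (simp add: glick_term_def corr_right_def flip: y_def)
      (simp add: scaleR_diff_right anti(3)[of b v d] mult_ac)
  have "\<omega> v y z / \<omega> x y z = \<omega> c e v / (\<omega> b c d * \<omega> a c e)"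
    using xyz by (simp add: yz xce cyc[of c e v])
  moreover have "\<omega> c d e *\<^sub>R x = \<omega> a c d *\<^sub>R y - (\<omega> b c d * \<omega> a c e) *\<^sub>R d"
    by (simp add: x(2) y(1) scaleR_add_right pl2 scaleR_diff_left mult.commute)
  then have "x = (1 / \<omega> c d e) *\<^sub>R (\<omega> a c d *\<^sub>R y - (\<omega> b c d * \<omega> a c e) *\<^sub>R d)"
    using nz by (intro eq_divide_scaleRI) simp_all
  ultimately have 2: "(\<omega> v y z / \<omega> x y z) *\<^sub>R x = glick_term \<omega> c d e v - corr_left \<omega> a b c d e v"
    using nz by (simp add: glick_term_def corr_left_def flip: y_def)
      (simp add: scaleR_diff_right anti(3)[of c v e] mult_ac)
  show ?thesis
    using det_form_cramer[OF dim \<omega> xyz, of v] unfolding 1 2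
    by (simp add: glick_term_def algebra_simps)
qed

text \<open>Both corrections lie in the span of c and e, and so does the right-hand side, as
  \<open>glick_term \<omega> c d e v\<close> removes the d-component of v. It remains to compare the
  coefficients of c and e.\<close>

lemma corr_sum:
  fixes b c d e f v :: "'v::real_vector"
  assumes dim: "dim (UNIV :: 'v set) = 3" and \<omega>: "det_form \<omega>"
    and nz: "\<omega> b c d \<noteq> 0" "\<omega> c d e \<noteq> 0" "\<omega> d e f \<noteq> 0" "\<omega> b d f \<noteq> 0"
  shows "corr_right \<omega> b c d e f v + corr_left \<omega> b c d e f v =
    glick_term \<omega> b c d v + glick_term \<omega> c d e v + glick_term \<omega> d e f v - v"
proof -
  note anti = det_form_antisym[OF \<omega>]
  note cyc = det_form_cycle[OF \<omega>]
  have y: "meet_lift \<omega> b c d e = \<omega> b d e *\<^sub>R c + \<omega> b c d *\<^sub>R e"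
    by (rule meet_lift_alt[OF dim \<omega>])
  have z: "meet_lift \<omega> c d e f = \<omega> c d f *\<^sub>R e + \<omega> d e f *\<^sub>R c"
    by (rule meet_lift_def)
  have v: "v = (\<omega> d e v / \<omega> c d e) *\<^sub>R c + glick_term \<omega> c d e v + (\<omega> c d v / \<omega> c d e) *\<^sub>R e"
    using det_form_cramer[OF dim \<omega> nz(2), of v] by (simp add: glick_term_def cyc)
  have pl: "\<omega> p d r * \<omega> d q v = \<omega> p d q * \<omega> d r v + \<omega> p d v * \<omega> d q r" for p q r
    using det_form_plucker[OF dim \<omega>, of p q d r v]
    by (simp add: anti(3)[of _ d] cyc[of _ _ d, symmetric])
  have "\<omega> b d c = - \<omega> b c d" "\<omega> d c e = - \<omega> c d e" "\<omega> d c v = - \<omega> c d v" "\<omega> d c f = - \<omega> c d f"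
    by (rule anti)+
  then have pl': "\<omega> b d e * \<omega> c d v = \<omega> b c d * \<omega> d e v + \<omega> b d v * \<omega> c d e"
    "\<omega> b d f * \<omega> c d v = \<omega> b c d * \<omega> d f v + \<omega> b d v * \<omega> c d f"
    using pl[of b e c] pl[of b f c] by simp_all
  \<comment> \<open>Here h stands for \<open>\<omega> b d f\<close>: once the numerator contains it,
    the pole along collinear b, d, f disappears.\<close>
  have frac: "- (p / (s * k * h)) * r - q / (k * h) = - (m / s) - t / k"
    if "p * r + q * s = h * (s * t + m * k)" "s \<noteq> 0" "k \<noteq> 0" "h \<noteq> 0" for p q r s t m h k :: real
  proof -
    have "(p * r + q * s) / (s * k * h) = m / s + t / k"
      unfolding that(1) using that(2-) by (simp add: field_simps)
    then have "p * r / (s * k * h) + q * s / (s * k * h) = m / s + t / k"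
      by (simp only: add_divide_distrib)
    then show ?thesis using that(2-) by (simp add: mult.commute mult.left_commute)
  qed
  \<comment> \<open>The first Pluecker exchange through d produces the factor
    \<open>\<omega> b d f\<close>, the second splits the cofactor as \<open>frac\<close>
    requires.\<close>
  have "\<omega> c d f * \<omega> b d v * \<omega> b d e + \<omega> b d e * \<omega> d f v * \<omega> b c d
      = \<omega> b d e * (\<omega> b d f * \<omega> c d v)"
    unfolding pl'(2) by (simp add: distrib_left mult_ac)
  also have "\<dots> = \<omega> b d f * (\<omega> b c d * \<omega> d e v + \<omega> b d v * \<omega> c d e)"
    unfolding mult.left_commute[of "\<omega> b d e"] pl'(1) ..
  finally have c: "- (\<omega> c d f * \<omega> b d v / (\<omega> b c d * \<omega> c d e * \<omega> b d f)) * \<omega> b d e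
      - (\<omega> b d e * \<omega> d f v / (\<omega> d e f * \<omega> c d e * \<omega> b d f)) * \<omega> d e f
      = - (\<omega> b d v / \<omega> b c d) - \<omega> d e v / \<omega> c d e"
    using frac nz by simp
  have "\<omega> b d e * \<omega> d f v * \<omega> c d f + \<omega> c d f * \<omega> b d v * \<omega> d e f
      = \<omega> c d f * (\<omega> b d f * \<omega> d e v)"
    unfolding pl[of b f e] by (simp add: distrib_left mult_ac)
  also have "\<dots> = \<omega> b d f * (\<omega> d e f * \<omega> c d v + \<omega> d f v * \<omega> c d e)"
    unfolding mult.left_commute[of "\<omega> c d f"] pl[of c f e] by (simp add: mult.commute)
  finally have e: "- (\<omega> c d f * \<omega> b d v / (\<omega> b c d * \<omega> c d e * \<omega> b d f)) * \<omega> b c d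
      - (\<omega> b d e * \<omega> d f v / (\<omega> d e f * \<omega> c d e * \<omega> b d f)) * \<omega> c d f
      = - (\<omega> d f v / \<omega> d e f) - \<omega> c d v / \<omega> c d e"
    using frac nz by fastforce
  have comb: "(- p) *\<^sub>R (q *\<^sub>R c + r *\<^sub>R e) + (- p') *\<^sub>R (r' *\<^sub>R e + q' *\<^sub>R c)
      = (- p * q - p' * q') *\<^sub>R c + (- p * r - p' * r') *\<^sub>R e" for p q r p' q' r'
    by (simp add: algebra_simps)
  have "corr_right \<omega> b c d e f v + corr_left \<omega> b c d e f v =
      (- (\<omega> b d v / \<omega> b c d) - \<omega> d e v / \<omega> c d e) *\<^sub>R c
      + (- (\<omega> d f v / \<omega> d e f) - \<omega> c d v / \<omega> c d e) *\<^sub>R e"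
    unfolding corr_right_def corr_left_def y z scaleR_minus_left[symmetric] comb c e ..
  also have "\<dots> = glick_term \<omega> b c d v + glick_term \<omega> d e f v
      - ((\<omega> d e v / \<omega> c d e) *\<^sub>R c + (\<omega> c d v / \<omega> c d e) *\<^sub>R e)"
    by (simp add: glick_term_def anti(3)[of _ v d] anti(3)[of _ v f] algebra_simps)
  also have "\<dots> = glick_term \<omega> b c d v + glick_term \<omega> c d e v + glick_term \<omega> d e f v - v"
    by (subst (2) v) (simp add: algebra_simps)
  finally show ?thesis .
qed

lemma sum_int_period_shift:
  fixes f :: "int \<Rightarrow> 'a::ab_group_add"
  assumes "\<And>i. f (i + int n) = f i"
  shows "(\<Sum>j = 1..int n. f (j - 1)) = (\<Sum>j = 1..int n. f j)"
proof -
  \<comment> \<open>The period n is fixed, so the induction runs over a free bound m and carries the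
    boundary terms, which cancel at m = n.\<close>
  have "(\<Sum>j = 1..int m. f (j - 1)) = (\<Sum>j = 1..int m. f j) + f 0 - f (int m)" for m
  proof (induction m)
    case (Suc m)
    have "{1..int (Suc m)} = insert (int (Suc m)) {1..int m}" by auto
    then show ?case using Suc by (simp add: algebra_simps)
  qed simp
  from this[of n] show ?thesis using assms[of 0] by simp
qed

text \<open>Five consecutive indices are distinct modulo n. This window suffices even for n = 5,
  where a and f lift the same vertex, because no determinant in the formulas contains both.\<close>

lemma general_position_lifts:
  fixes A :: "int \<Rightarrow> 'v::real_vector set"
  assumes n: "n \<ge> 5" and dim: "dim (UNIV :: 'v set) = 3" and \<omega>: "det_form \<omega>"
    and gp: "general_position n A" and Au: "\<And>i. A i = span {u i}"
    and ord: "i < k" "k < l" "l < i + 5"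
  shows "\<omega> (u i) (u k) (u l) \<noteq> 0"
proof -
  have distinct: "i mod int n \<noteq> k mod int n" if "i < k" "k < i + 5" for i k
  proof
    assume "i mod int n = k mod int n"
    then have "int n dvd k - i" by (metis mod_eq_dvd_iff)
    then show False using that n by (auto dest!: zdvd_imp_le)
  qed
  have "i mod int n \<noteq> k mod int n" "i mod int n \<noteq> l mod int n" "k mod int n \<noteq> l mod int n"
    using ord by (simp_all add: distinct)
  then show ?thesis
    using gp by (intro not_collinear_imp_det_nonzero[OF dim \<omega>]) (auto simp: general_position_def Au)
qed

theorem theorem3p1:
  fixes n :: nat and A :: "int \<Rightarrow> 'v::real_vector set"
  assumes "n \<ge> 5"
    and "dim (UNIV :: 'v set) = 3"
    and "polygon n A"
    and "general_position n A"
  shows "glick_operator n (pentagram A) = glick_operator n A"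
proof
  fix v :: 'v
  note dim = assms(2)
  obtain \<omega> :: "'v \<Rightarrow> 'v \<Rightarrow> 'v \<Rightarrow> real" where \<omega>: "det_form \<omega>" using det_form_exists[OF dim] by blast
  have pts: "A i \<in> proj_points" for i using assms(3) by (simp add: polygon_def)
  \<comment> \<open>This choice depends only on the set \<open>A i\<close>, so the lifts inherit its
    periodicity.\<close>
  define u where "u i = (SOME x. is_lift x (A i))" for i
  have u: "is_lift (u i) (A i)" for i
    unfolding u_def using proj_point_lift_exists[OF pts] by (rule someI_ex)
  have Au: "A i = span {u i}" for i by (rule proj_point_eq_span[OF pts u])
  note nz = general_position_lifts[OF assms(1) dim \<omega> assms(4) Au]
  have per: "u (i + int n) = u i" for i using assms(3) by (simp add: u_def polygon_def)
  define w where "w i = meet_lift \<omega> (u (i - 1)) (u i) (u (i + 1)) (u (i + 2))" for i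
  have Bw: "pentagram A i = span {w i}" and w0: "w i \<noteq> 0" for i
    unfolding pentagram_def Au w_def meet_lift_def by (rule lines_meet[OF dim \<omega> nz nz]; simp)+
  have w: "is_lift (w i) (pentagram A i)" for i
    unfolding Bw by (rule span_singleton_proj_point(2)[OF w0])
  have wnz: "\<omega> (w (j - 1)) (w j) (w (j + 1)) \<noteq> 0" for j
    using pentagram_well_defined(2)[OF assms, of j] unfolding Bw
    by (rule not_collinear_imp_det_nonzero[OF dim \<omega>])
  have ptsB: "pentagram A i \<in> proj_points" for i
    using pentagram_well_defined(1)[OF assms] by (simp add: polygon_def)
  define P where "P j = glick_term \<omega> (u (j - 1)) (u j) (u (j + 1)) v" for j
  define M where "M j = corr_right \<omega> (u (j - 1)) (u j) (u (j + 1)) (u (j + 2)) (u (j + 3)) v" for j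
  define N where "N j = corr_left \<omega> (u (j - 2)) (u (j - 1)) (u j) (u (j + 1)) (u (j + 2)) v" for j
  have shift: "j - 1 + 1 = j" "j - 1 - 1 = j - 2" "j - 1 + 2 = j + 1" "j - 1 + 3 = j + 2"
    "j + 1 - 1 = j" "j + 1 + 1 = j + 2" "j + 1 + 2 = j + 3" for j :: int by simp_all
  have step: "glick_term \<omega> (w (j - 1)) (w j) (w (j + 1)) v = P (j - 1) + M j - M (j - 1)" for j
  proof -
    have "glick_term \<omega> (w (j - 1)) (w j) (w (j + 1)) v = v - P j - P (j + 1) + M j + N j"
      using wnz[of j] unfolding w_def P_def M_def N_def shift
      by (intro glick_term_meet_lift[OF dim \<omega>] nz) simp_all
    \<comment> \<open>\<open>M (j - 1)\<close> and \<open>N j\<close> belong to neighbouring points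
      of the image but involve the same five lifts, so \<open>N j\<close> can be eliminated.\<close>
    moreover have "M (j - 1) + N j = P (j - 1) + P j + P (j + 1) - v"
      unfolding P_def M_def N_def shift
      by (intro corr_sum[OF dim \<omega>] nz) simp_all
    then have "N j = P (j - 1) + P j + P (j + 1) - v - M (j - 1)" by (simp add: algebra_simps)
    ultimately show ?thesis by simp
  qed
  have per': "u (i + int n + k) = u (i + k)" "u (i + int n - k) = u (i - k)" for i k
    using per[of "i + k"] per[of "i - k"] by (simp_all add: algebra_simps)
  have "(\<Sum>j = 1..int n. glick_term \<omega> (w (j - 1)) (w j) (w (j + 1)) v)
      = (\<Sum>j = 1..int n. P (j - 1)) + (\<Sum>j = 1..int n. M j) - (\<Sum>j = 1..int n. M (j - 1))"
    by (simp add: step sum.distrib sum_subtractf)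
  also have "(\<Sum>j = 1..int n. P (j - 1)) = (\<Sum>j = 1..int n. P j)"
    by (rule sum_int_period_shift) (simp add: P_def per per')
  also have "(\<Sum>j = 1..int n. M (j - 1)) = (\<Sum>j = 1..int n. M j)"
    by (rule sum_int_period_shift) (simp add: M_def per per')
  finally show "glick_operator n (pentagram A) v = glick_operator n A v"
    unfolding glick_operator_eq[OF dim pts \<omega> u] glick_operator_eq[OF dim ptsB \<omega> w]
    by (simp add: glick_formula_def glick_term_def P_def)
qed

end
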